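(* Let $a,b,c,p,q,r\in\mathbb{R}$ and let $Q(x,y,z):=ax^2+2bxy+2pxz+cy^2+2qyz+rz^2$ be the corresponding ternary quadratic form in the variables $x$, $y$ and $z$. Let $$A:=\begin{pmatrix} a & b & p\\ b & c & q\\ p & q & r\end{pmatrix}\quad\text{and}\quad \Delta:=\det A = p(bq-cp)+q(bp-aq)+r(ac-b^2).$$ Then $Q(x,y,z)$ is nonnegative definite if and only if all the principal minors of $A$ are nonnegative, i.e., $$a\ge 0,\ c\ge 0,\ r\ge 0,\ ac-b^2\ge 0,\ cr-q^2\ge 0,\ ar-p^2\ge 0\ \text{ and }\ \Delta\ge 0.$$
   Context: A real quadratic form $Q$ in $n$ variables is called nonnegative definite if $Q(\mathbf{x})\ge 0$ for all $\mathbf{x}\in\mathbb{R}^n$, $\mathbf{x}\neq\mathbf{0}$. A principal minor of a square matrix is the determinant of a square submatrix whose chosen rows and columns have the same indices. *)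

theory Defs
  imports "Jordan_Normal_Form.Determinant" "Jordan_Normal_Form.DL_Submatrix"
begin

definition nonneg_definite :: "nat \<Rightarrow> (real vec \<Rightarrow> real) \<Rightarrow> bool" where
  "nonneg_definite n Q \<longleftrightarrow> (\<forall>v \<in> carrier_vec n. v \<noteq> 0\<^sub>v n \<longrightarrow> Q v \<ge> 0)"

text \<open>The empty minor (which would be 1) is not counted.\<close>

definition principal_minors :: "'a :: comm_ring_1 mat \<Rightarrow> 'a set" where
  "principal_minors A =
     {det (submatrix A I I) | I. I \<noteq> {} \<and> I \<subseteq> {..<dim_row A} \<and> I \<subseteq> {..<dim_col A}}"

definition ternary_form ::
    "real \<Rightarrow> real \<Rightarrow> real \<Rightarrow> real \<Rightarrow> real \<Rightarrow> real \<Rightarrow> real \<Rightarrow> real \<Rightarrow> real \<Rightarrow> real" where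
  "ternary_form a b c p q r x y z =
     a * x\<^sup>2 + 2 * b * x * y + 2 * p * x * z + c * y\<^sup>2 + 2 * q * y * z + r * z\<^sup>2"

definition ternary_matrix ::
    "real \<Rightarrow> real \<Rightarrow> real \<Rightarrow> real \<Rightarrow> real \<Rightarrow> real \<Rightarrow> real mat" where
  "ternary_matrix a b c p q r =
     mat_of_rows_list 3 [[a, b, p],
                         [b, c, q],
                         [p, q, r]]"

end

theory Submission
  imports Defs
begin

text \<open>
  For necessity, the values of \<open>Q\<close> at the columns of the adjugate of \<open>A\<close> are \<open>\<Delta>\<close> times the
  \<open>2 \<times> 2\<close> principal minors, which gives \<open>\<Delta> \<ge> 0\<close> unless \<open>a c - b\<^sup>2 = 0\<close>; in that case
  \<open>Q\<close> restricted to \<open>z = 0\<close> is degenerate and \<open>\<Delta> = 0\<close>. For sufficiency with \<open>a > 0\<close>, completing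
  the square in \<open>a Q\<close> leaves a binary form in \<open>y, z\<close> whose determinant is \<open>a \<Delta>\<close>.
\<close>

section \<open>Explicit determinants and principal minors of small matrices\<close>

lemma det_2_by_2:
  fixes A :: "'a :: comm_ring_1 mat"
  assumes A: "A \<in> carrier_mat 2 2"
  shows "det A = A $$ (0,0) * A $$ (1,1) - A $$ (0,1) * A $$ (1,0)"
proof -
  have "det (mat_delete A 0 j) = mat_delete A 0 j $$ (0,0)" for j
    by (rule det_single) (use mat_delete_carrier[OF A] in simp)
  then show ?thesis
    using A unfolding laplace_expansion_row[OF A zero_less_numeral]
    by (simp add: cofactor_def mat_delete_def numeral_2_eq_2)
qed

lemma det_3_by_3:
  fixes A :: "'a :: comm_ring_1 mat"
  assumes A: "A \<in> carrier_mat 3 3"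
  shows "det A = A $$ (0,0) * (A $$ (1,1) * A $$ (2,2) - A $$ (1,2) * A $$ (2,1))
               - A $$ (0,1) * (A $$ (1,0) * A $$ (2,2) - A $$ (1,2) * A $$ (2,0))
               + A $$ (0,2) * (A $$ (1,0) * A $$ (2,1) - A $$ (1,1) * A $$ (2,0))"
proof -
  have "mat_delete A 0 j \<in> carrier_mat 2 2" for j
    using mat_delete_carrier[OF A] by simp
  note d = det_2_by_2[OF this]
  have s: "{..<3::nat} = {0,1,2}" by auto
  show ?thesis
    using A unfolding laplace_expansion_row[OF A zero_less_numeral] s
    \<comment> \<open>\<open>d\<close> matches only while \<open>mat_delete\<close> stays folded, so
      the entries are evaluated in a second pass.\<close>
    by (simp add: cofactor_def d) (simp add: mat_delete_def numeral_2_eq_2 algebra_simps)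
qed

lemma pick_singleton: "pick {i} 0 = i"
  by (auto intro: Least_equality)

lemma pick_doubleton:
  assumes "i < j"
  shows "pick {i, j} 0 = i" "pick {i, j} 1 = j"
proof -
  show 0: "pick {i, j} 0 = i"
    using assms by (auto intro!: Least_equality)
  show "pick {i, j} 1 = j"
    unfolding One_nat_def pick.simps(2) 0 using assms by (auto intro!: Least_equality)
qed

lemma det_submatrix_singleton:
  fixes A :: "'a :: comm_ring_1 mat"
  assumes "A \<in> carrier_mat n n" "i < n"
  shows "det (submatrix A {i} {i}) = A $$ (i,i)"
proof -
  have "{k. k < n \<and> k \<in> {i}} = {i}"
    using assms by auto
  then show ?thesis
    using assms by (simp add: submatrix_def det_single pick_singleton del: pick.simps)
qed

lemma det_submatrix_doubleton:
  fixes A :: "'a :: comm_ring_1 mat"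
  assumes "A \<in> carrier_mat n n" "i < j" "j < n"
  shows "det (submatrix A {i, j} {i, j}) = A $$ (i,i) * A $$ (j,j) - A $$ (i,j) * A $$ (j,i)"
proof -
  have "{k. k < n \<and> k \<in> {i, j}} = {i, j}"
    using assms by auto
  then have "submatrix A {i, j} {i, j} = mat 2 2 (\<lambda>(k,l). A $$ (pick {i, j} k, pick {i, j} l))"
    using assms by (simp add: submatrix_def numeral_2_eq_2)
  then show ?thesis
    using pick_doubleton[OF assms(2)]
    \<comment> \<open>Without these deletions \<open>pick {i, j} 1\<close> would lose the shape that
      \<open>pick_doubleton\<close> rewrites.\<close>
    by (simp add: det_2_by_2 del: pick.simps One_nat_def)
qed

lemma submatrix_full:
  assumes A: "A \<in> carrier_mat n n"
  shows "submatrix A {..<n} {..<n} = A"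
proof -
  have "pick {..<n} k = k" if "k < n" for k
  proof -
    \<comment> \<open>An element of a set is picked at the position that counts its smaller
      elements; in an initial segment that position is the element itself.\<close>
    have "{a \<in> {..<n}. a < k} = {..<k}" using that by auto
    then show ?thesis using pick_card_in_set[of k "{..<n}"] that by simp
  qed
  then show ?thesis
    using A by (intro eq_matI) (auto simp: submatrix_def)
qed

lemma principal_minors_3_by_3:
  assumes A: "A \<in> carrier_mat 3 3"
  shows "principal_minors A =
    {A $$ (0,0), A $$ (1,1), A $$ (2,2),
     A $$ (0,0) * A $$ (1,1) - A $$ (0,1) * A $$ (1,0),
     A $$ (1,1) * A $$ (2,2) - A $$ (1,2) * A $$ (2,1),
     A $$ (0,0) * A $$ (2,2) - A $$ (0,2) * A $$ (2,0),
     det A}"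
proof -
  have s: "{..<3::nat} = {0,1,2}" by auto
  have "{I. I \<noteq> {} \<and> I \<subseteq> {0,1,2::nat}} = Pow {0,1,2} - {{}}"
    by auto
  also have "\<dots> = {{0}, {1}, {2}, {0,1}, {1,2}, {0,2}, {0,1,2}}"
    by (auto simp: Pow_insert)
  \<comment> \<open>The full index set becomes \<open>{..<3}\<close> again so that
    \<open>submatrix_full\<close> applies; pairs are listed in increasing order for
    \<open>det_submatrix_doubleton\<close>.\<close>
  finally have I: "{I. I \<noteq> {} \<and> I \<subseteq> {..<3::nat}} = {{0}, {1}, {2}, {0,1}, {1,2}, {0,2}, {..<3}}"
    by (simp only: s)
  have "principal_minors A = (\<lambda>I. det (submatrix A I I)) ` {I. I \<noteq> {} \<and> I \<subseteq> {..<3}}"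
    using A by (auto simp: principal_minors_def)
  then show ?thesis
    unfolding I
    by (simp add: det_submatrix_singleton[OF A] det_submatrix_doubleton[OF A] submatrix_full[OF A]
        del: One_nat_def)
qed

section \<open>The ternary matrix, and real quadratic forms in two and three variables\<close>

lemma ternary_matrix_carrier: "ternary_matrix a b c p q r \<in> carrier_mat 3 3"
  by (rule carrier_matI) (simp_all add: ternary_matrix_def mat_of_rows_list_def)

lemma ternary_matrix_index:
  "ternary_matrix a b c p q r $$ (0,0) = a" "ternary_matrix a b c p q r $$ (0,1) = b"
  "ternary_matrix a b c p q r $$ (0,2) = p" "ternary_matrix a b c p q r $$ (1,0) = b"
  "ternary_matrix a b c p q r $$ (1,1) = c" "ternary_matrix a b c p q r $$ (1,2) = q"
  "ternary_matrix a b c p q r $$ (2,0) = p" "ternary_matrix a b c p q r $$ (2,1) = q"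
  "ternary_matrix a b c p q r $$ (2,2) = r"
  by (simp_all add: ternary_matrix_def mat_of_rows_list_def)

text \<open>\<open>nonneg_definite\<close> tests nonzero vectors only; the assumption supplies the
  value at the origin.\<close>

lemma nonneg_definite_3_iff:
  assumes "Q 0 0 0 = 0"
  shows "nonneg_definite 3 (\<lambda>v. Q (v $ 0) (v $ 1) (v $ 2)) \<longleftrightarrow> (\<forall>x y z. Q x y z \<ge> 0)"
proof
  assume Q: "nonneg_definite 3 (\<lambda>v. Q (v $ 0) (v $ 1) (v $ 2))"
  show "\<forall>x y z. Q x y z \<ge> 0"
  proof (intro allI)
    fix x y z :: real
    define v where "v = vec 3 (\<lambda>i. if i = 0 then x else if i = 1 then y else z)"
    have v: "v \<in> carrier_vec 3" "v $ 0 = x" "v $ 1 = y" "v $ 2 = z"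
      by (simp_all add: v_def)
    show "Q x y z \<ge> 0"
    proof (cases "v = 0\<^sub>v 3")
      case True
      then have "x = 0" "y = 0" "z = 0"
        using v by auto
      then show ?thesis using assms by simp
    next
      case False
      then show ?thesis
        using Q v unfolding nonneg_definite_def by metis
    qed
  qed
qed (simp add: nonneg_definite_def)

text \<open>Multiplying the form by \<open>a\<close> and completing the square leaves
  \<open>(a * c - b\<^sup>2) * y\<^sup>2\<close>. The ternary case uses this on the coordinate
  planes and on forms derived from \<open>Q\<close>.\<close>

lemma binary_form_nonneg_iff:
  fixes a b c :: real
  shows "(\<forall>x y. a * x\<^sup>2 + 2 * b * x * y + c * y\<^sup>2 \<ge> 0) \<longleftrightarrow> a \<ge> 0 \<and> c \<ge> 0 \<and> a * c - b\<^sup>2 \<ge> 0"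
    (is "?L \<longleftrightarrow> ?R")
proof
  assume ?L
  then have f: "a * x\<^sup>2 + 2 * b * x * y + c * y\<^sup>2 \<ge> 0" for x y by blast
  have a: "a \<ge> 0" and c: "c \<ge> 0"
    using f[of 1 0] f[of 0 1] by simp_all
  have "a * c - b\<^sup>2 \<ge> 0"
  proof (cases "a = 0")
    case True
    \<comment> \<open>For \<open>a = 0\<close> the value at \<open>(x, b)\<close> is
      \<open>(2 * x + c) * b\<^sup>2\<close>. Taking \<open>x = - (c + 1)\<close> makes the factor
      \<open>- (c + 2)\<close>, negative since \<open>c \<ge> 0\<close>, which forces
      \<open>b = 0\<close>.\<close>
    have "c * b\<^sup>2 + 2 * b * - (c + 1) * b \<ge> 0"
      using f[of "- (c + 1)" b] True by (simp add: algebra_simps)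
    then have "(c + 2) * b\<^sup>2 \<le> 0"
      by (simp add: algebra_simps power2_eq_square)
    then show ?thesis
      using c True by (auto simp: mult_le_0_iff)
  next
    case False
    \<comment> \<open>The point \<open>(b, - a)\<close> annihilates the completed square
      \<open>a * x + b * y\<close>.\<close>
    have "a * (a * c - b\<^sup>2) \<ge> 0"
      using f[of b "- a"] by (simp add: algebra_simps power2_eq_square)
    then show ?thesis
      using a False by (simp add: zero_le_mult_iff)
  qed
  with a c show ?R by simp
next
  assume R: ?R
  show ?L
  proof (intro allI)
    fix x y
    show "a * x\<^sup>2 + 2 * b * x * y + c * y\<^sup>2 \<ge> 0"
    proof (cases "a = 0")
      case True
      then show ?thesis using R by simp
    next
      case False
      have "a * (a * x\<^sup>2 + 2 * b * x * y + c * y\<^sup>2) = (a * x + b * y)\<^sup>2 + (a * c - b\<^sup>2) * y\<^sup>2"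
        by (simp add: algebra_simps power2_eq_square)
      also have "\<dots> \<ge> 0" using R by simp
      finally show ?thesis using R False by (simp add: zero_le_mult_iff)
    qed
  qed
qed

lemma ternary_form_nonneg_iff:
  "(\<forall>x y z. ternary_form a b c p q r x y z \<ge> 0) \<longleftrightarrow>
     a \<ge> 0 \<and> c \<ge> 0 \<and> r \<ge> 0 \<and> a * c - b\<^sup>2 \<ge> 0 \<and> c * r - q\<^sup>2 \<ge> 0 \<and> a * r - p\<^sup>2 \<ge> 0 \<and>
     p * (b * q - c * p) + q * (b * p - a * q) + r * (a * c - b\<^sup>2) \<ge> 0"
    (is "?L \<longleftrightarrow> ?R")
proof
  let ?D = "p * (b * q - c * p) + q * (b * p - a * q) + r * (a * c - b\<^sup>2)"
  assume ?L
  then have f: "ternary_form a b c p q r x y z \<ge> 0" for x y z by blast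
  \<comment> \<open>Restriction to the three coordinate planes yields all minors of order one and
    two.\<close>
  have xy: "a \<ge> 0 \<and> c \<ge> 0 \<and> a * c - b\<^sup>2 \<ge> 0"
    using f[of _ _ 0] unfolding binary_form_nonneg_iff[symmetric] by (simp add: ternary_form_def)
  have yz: "c \<ge> 0 \<and> r \<ge> 0 \<and> c * r - q\<^sup>2 \<ge> 0"
    using f[of 0] unfolding binary_form_nonneg_iff[symmetric] by (simp add: ternary_form_def)
  have xz: "a \<ge> 0 \<and> r \<ge> 0 \<and> a * r - p\<^sup>2 \<ge> 0"
    using f[of _ 0] unfolding binary_form_nonneg_iff[symmetric] by (simp add: ternary_form_def)
  have "?D \<ge> 0"
  proof (cases "a * c - b\<^sup>2 = 0")
    case False
    \<comment> \<open>This vector is the last column of the adjugate: the matrix sends it to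
      \<open>(0, 0, ?D)\<close>, so only its third coordinate contributes to the value.\<close>
    have "ternary_form a b c p q r (b * q - c * p) (b * p - a * q) (a * c - b\<^sup>2) = ?D * (a * c - b\<^sup>2)"
      unfolding ternary_form_def by (simp add: algebra_simps power2_eq_square)
    then show ?thesis
      using f[of "b * q - c * p" "b * p - a * q" "a * c - b\<^sup>2"] xy False
      by (simp add: zero_le_mult_iff)
  next
    case deg: True
    show ?thesis
    proof (cases "a = 0")
      case True
      \<comment> \<open>The minors \<open>- b\<^sup>2\<close> and \<open>- p\<^sup>2\<close> are
        nonnegative, so the whole first row vanishes.\<close>
      then have "b = 0" "p = 0" using deg xz by simp_all
      then show ?thesis using True by simp
    next
      case False
      \<comment> \<open>The vector \<open>(- b, a, 0)\<close> is isotropic because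
        \<open>a * c = b\<^sup>2\<close>. On the plane it spans with the z-axis the leading
        coefficient is 0, so nonnegativity kills the mixed term.\<close>
      have "0 * s\<^sup>2 + 2 * (a * q - b * p) * s * z + r * z\<^sup>2 \<ge> 0" for s z
      proof -
        have "ternary_form a b c p q r (- b * s) (a * s) z
            = a * (a * c - b\<^sup>2) * s\<^sup>2 + 2 * (a * q - b * p) * s * z + r * z\<^sup>2"
          unfolding ternary_form_def by (simp add: algebra_simps power2_eq_square)
        then show ?thesis using f[of "- b * s" "a * s" z] deg by simp
      qed
      then have "0 * r - (a * q - b * p)\<^sup>2 \<ge> 0"
        using binary_form_nonneg_iff[of 0 "a * q - b * p" r] by blast
      then have "a * q - b * p = 0" by simp
      \<comment> \<open>Condensation with pivot \<open>a\<close>: the 2 by 2 determinant of the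
        minors bordering \<open>a\<close> equals \<open>a * ?D\<close>.\<close>
      moreover have "a * ?D = (a * c - b\<^sup>2) * (a * r - p\<^sup>2) - (a * q - b * p)\<^sup>2"
        by (simp add: algebra_simps power2_eq_square)
      ultimately have "a * ?D = 0" using deg by simp
      then show ?thesis using False by simp
    qed
  qed
  with xy yz xz show ?R by blast
next
  let ?D = "p * (b * q - c * p) + q * (b * p - a * q) + r * (a * c - b\<^sup>2)"
  assume R: ?R
  show ?L
  proof (intro allI)
    fix x y z
    show "ternary_form a b c p q r x y z \<ge> 0"
    proof (cases "a = 0")
      case True
      then have "b = 0" "p = 0" using R by simp_all
      then have "ternary_form a b c p q r x y z = c * y\<^sup>2 + 2 * q * y * z + r * z\<^sup>2"
        using True by (simp add: ternary_form_def)
      then show ?thesis using binary_form_nonneg_iff[of c q r] R by simp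
    next
      case False
      have "(a * c - b\<^sup>2) * (a * r - p\<^sup>2) - (a * q - b * p)\<^sup>2 = a * ?D"
        by (simp add: algebra_simps power2_eq_square)
      also have "\<dots> \<ge> 0" using R by simp
      \<comment> \<open>The outer coefficients of this binary form are principal minors, hence
        nonnegative by \<open>R\<close>; its determinant was just treated.\<close>
      finally have "(a * c - b\<^sup>2) * y\<^sup>2 + 2 * (a * q - b * p) * y * z + (a * r - p\<^sup>2) * z\<^sup>2 \<ge> 0"
        using binary_form_nonneg_iff[of "a * c - b\<^sup>2" "a * q - b * p" "a * r - p\<^sup>2"] R by blast
      moreover have "a * ternary_form a b c p q r x y z = (a * x + b * y + p * z)\<^sup>2 +
          ((a * c - b\<^sup>2) * y\<^sup>2 + 2 * (a * q - b * p) * y * z + (a * r - p\<^sup>2) * z\<^sup>2)"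
        unfolding ternary_form_def by (simp add: algebra_simps power2_eq_square)
      ultimately have "a * ternary_form a b c p q r x y z \<ge> 0" by simp
      then show ?thesis using R False by (simp add: zero_le_mult_iff)
    qed
  qed
qed

theorem proposition3p1:
  fixes a b c p q r :: real
  shows
    "let Q = ternary_form a b c p q r;
         A = ternary_matrix a b c p q r;
         \<Delta> = det A
     in \<Delta> = p * (b * q - c * p) + q * (b * p - a * q) + r * (a * c - b\<^sup>2) \<and>
        (nonneg_definite 3 (\<lambda>v. Q (v $ 0) (v $ 1) (v $ 2)) \<longleftrightarrow>
           (\<forall>m \<in> principal_minors A. m \<ge> 0)) \<and>
        ((\<forall>m \<in> principal_minors A. m \<ge> 0) \<longleftrightarrow>
           a \<ge> 0 \<and> c \<ge> 0 \<and> r \<ge> 0 \<and>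
           a * c - b\<^sup>2 \<ge> 0 \<and> c * r - q\<^sup>2 \<ge> 0 \<and> a * r - p\<^sup>2 \<ge> 0 \<and> \<Delta> \<ge> 0)"
proof -
  let ?A = "ternary_matrix a b c p q r"
  have det: "det ?A = p * (b * q - c * p) + q * (b * p - a * q) + r * (a * c - b\<^sup>2)"
    unfolding det_3_by_3[OF ternary_matrix_carrier] ternary_matrix_index by (simp add: algebra_simps power2_eq_square)
  have minors: "(\<forall>m \<in> principal_minors ?A. m \<ge> 0) \<longleftrightarrow>
      a \<ge> 0 \<and> c \<ge> 0 \<and> r \<ge> 0 \<and>
      a * c - b\<^sup>2 \<ge> 0 \<and> c * r - q\<^sup>2 \<ge> 0 \<and> a * r - p\<^sup>2 \<ge> 0 \<and> det ?A \<ge> 0"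
    unfolding principal_minors_3_by_3[OF ternary_matrix_carrier] ternary_matrix_index
    by (simp add: power2_eq_square)
  have "nonneg_definite 3 (\<lambda>v. ternary_form a b c p q r (v $ 0) (v $ 1) (v $ 2)) \<longleftrightarrow>
      (\<forall>m \<in> principal_minors ?A. m \<ge> 0)"
    \<comment> \<open>Once \<open>det\<close> is expanded, the seven inequalities are the right side
      of \<open>ternary_form_nonneg_iff\<close> and fold back into nonnegativity on all
      triples.\<close>
    unfolding minors det ternary_form_nonneg_iff[symmetric]
    by (rule nonneg_definite_3_iff) (simp add: ternary_form_def)
  with det minors show ?thesis
    unfolding Let_def by blast
qed

end
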